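(* Let $a,b\ge 0$ be integers, $n=a+b$. For all integers $r,s$ with $0 \leq s < b$ and $0 \leq r \leq a$ we have \[ \sum_{PF \in \mathcal{PF}_{a,b}^{(r,s)}} q^{\operatorname{coarea}(PF)+\operatorname{dinv}(PF)} = q^{\binom{a+b}{2}-(a-r+1)(b-s)} \begin{bmatrix} a+b-s-1 \\ a \end{bmatrix}_q \begin{bmatrix} a-r+b-s \\ a-r \end{bmatrix}_q \begin{bmatrix} r+s \\ s \end{bmatrix}_q \frac{[r]_q}{[a-r+b-s]_q}, \] and for all $b\ge 0$ and $0 \leq r \leq a$ we have \[ \sum_{PF \in \mathcal{PF}_{a,b}^{(r,b)}} q^{\operatorname{coarea}(PF)+\operatorname{dinv}(PF)} = \chi(a=r)\, q^{\binom{a+b}{2}} \begin{bmatrix} a+b \\ a \end{bmatrix}_q . \]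
   Context: A parking function of size $n$ is a two-line array $PF=\begin{bmatrix} v_1 & \cdots & v_n \\ u_1 & \cdots & u_n\end{bmatrix}$ where $u_1=0$, $0\le u_i\le u_{i-1}+1$ for $i\ge 2$, $(v_1,\dots,v_n)$ is a permutation of $\{1,\dots,n\}$, and $u_i=u_{i-1}+1$ implies $v_i>v_{i-1}$. (Geometrically: a Dyck path in the $n\times n$ square whose north steps are labeled column-increasingly by "cars" $1,\dots,n$; $v_i$ is the car in row $i$ and $u_i$ is the number of full cells in row $i$ between the path and the main diagonal; car $v_i$ lies on the main diagonal iff $u_i=0$.) Define $\operatorname{area}(PF)=\sum_i u_i$, $\operatorname{coarea}(PF)=\binom{n}{2}-\operatorname{area}(PF)$, and $\operatorname{dinv}(PF)=\#\{i<j: u_i=u_j,\ v_i<v_j\}+\#\{i<j: u_i=u_j+1,\ v_i>v_j\}$. The diagonal (reading) word $\sigma(PF)$ is obtained by listing the cars $v_i$ in order of decreasing value of $u_i$, and, among indices with the same value of $u_i$, in decreasing order of the index $i$ (right to left). For $a+b=n$, the cars $1,\dots,a$ are "small" and $a+1,\dots,a+b$ are "big". $\mathcal{PF}_{a,b}^{(r,s)}$ is the set of parking functions of size $n$ whose word $\sigma(PF)$ is a shuffle of the words $1\,2\cdots a$ and $(a+1)(a+2)\cdots(a+b)$, and which have exactly $r$ small cars and exactly $s$ big cars on the main diagonal (i.e. with $u_i=0$). $[m]_q=1+q+\dots+q^{m-1}$, $[m]_q!=[1]_q\cdots[m]_q$, $\begin{bmatrix} m\\ k\end{bmatrix}_q=\frac{[m]_q!}{[k]_q![m-k]_q!}$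 for $0\le k\le m$ (and $0$ otherwise); $\chi(P)$ is $1$ if $P$ is true and $0$ otherwise. *)

theory Defs
  imports
    "HOL-Combinatorics.Multiset_Permutations"
    "HOL-Computational_Algebra.Polynomial"
    "HOL-Computational_Algebra.Fraction_Field"
begin

text \<open>
  A two-line array is a pair \<open>(v, u)\<close> of lists of equal length \<open>n\<close>. List positions start at 0, so the
  entries \<open>v\<^sub>i\<close>, \<open>u\<^sub>i\<close> of the mathematical notation are \<open>v ! (i - 1)\<close>, \<open>u ! (i - 1)\<close>.
\<close>

type_synonym two_line = "nat list \<times> nat list"

definition parking_functions :: "nat \<Rightarrow> two_line set" where
  "parking_functions n = {(v, u).
     v \<in> permutations_of_set {1..n} \<and> length u = n \<and>
     (0 < n \<longrightarrow> u ! 0 = 0) \<and>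
     (\<forall>i. 0 < i \<and> i < n \<longrightarrow> u ! i \<le> u ! (i - 1) + 1) \<and>
     (\<forall>i. 0 < i \<and> i < n \<and> u ! i = u ! (i - 1) + 1 \<longrightarrow> v ! i > v ! (i - 1))}"

fun area :: "two_line \<Rightarrow> nat" where
  "area (v, u) = sum_list u"

text \<open>Integer-valued, so that the subtraction is not truncated.\<close>

fun coarea :: "two_line \<Rightarrow> int" where
  "coarea (v, u) = int (length u choose 2) - int (area (v, u))"

fun dinv :: "two_line \<Rightarrow> nat" where
  "dinv (v, u) =
     card {(i, j). i < j \<and> j < length u \<and> u ! i = u ! j \<and> v ! i < v ! j} +
     card {(i, j). i < j \<and> j < length u \<and> u ! i = u ! j + 1 \<and> v ! i > v ! j}"

text \<open>
  In a parking function of size \<open>n\<close> every entry of \<open>u\<close> is less than \<open>n\<close>, so letting \<open>d\<close> run through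
  \<open>n - 1, \<dots>, 0\<close> reaches all cars.
\<close>

fun diagonal_word :: "two_line \<Rightarrow> nat list" where
  "diagonal_word (v, u) =
     concat (map (\<lambda>d. map (\<lambda>i. v ! i) (filter (\<lambda>i. u ! i = d) (rev [0..<length u])))
       (rev [0..<length u]))"

fun small_on_diagonal :: "nat \<Rightarrow> two_line \<Rightarrow> nat" where
  "small_on_diagonal a (v, u) = card {i. i < length u \<and> u ! i = 0 \<and> v ! i \<le> a}"

fun big_on_diagonal :: "nat \<Rightarrow> two_line \<Rightarrow> nat" where
  "big_on_diagonal a (v, u) = card {i. i < length u \<and> u ! i = 0 \<and> v ! i > a}"

definition PF_shuffle :: "nat \<Rightarrow> nat \<Rightarrow> nat \<Rightarrow> nat \<Rightarrow> two_line set" where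
  "PF_shuffle a b r s = {P \<in> parking_functions (a + b).
     diagonal_word P \<in> shuffles [1..<a + 1] [a + 1..<a + b + 1] \<and>
     small_on_diagonal a P = r \<and> big_on_diagonal a P = s}"

lemma parking_functions_nth_le:
  assumes "(v, u) \<in> parking_functions n" "i < n"
  shows "u ! i \<le> i"
  using assms(2)
proof (induction i)
  case 0
  then show ?case using assms(1) by (auto simp: parking_functions_def)
next
  case (Suc i)
  then have "u ! Suc i \<le> u ! i + 1"
    using assms(1) unfolding parking_functions_def by force
  with Suc show ?case by simp
qed

text \<open>Hence the sum over \<open>PF_shuffle a b r s\<close> is a genuine finite sum.\<close>

lemma finite_parking_functions: "finite (parking_functions n)"
proof (rule finite_subset)
  show "parking_functions n \<subseteq>
      permutations_of_set {1..n} \<times> {u. set u \<subseteq> {..n} \<and> length u = n}"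
  proof clarify
    fix v u assume P: "(v, u) \<in> parking_functions n"
    then have "v \<in> permutations_of_set {1..n}" and len: "length u = n"
      by (auto simp: parking_functions_def)
    moreover have "set u \<subseteq> {..n}"
      using parking_functions_nth_le[OF P] len by (fastforce simp: in_set_conv_nth)
    ultimately show "v \<in> permutations_of_set {1..n} \<and> u \<in> {u. set u \<subseteq> {..n} \<and> length u = n}"
      by simp
  qed
  show "finite (permutations_of_set {1..n} \<times> {u. set u \<subseteq> {..n} \<and> length u = n})"
    by (intro finite_cartesian_product finite_lists_length_eq) auto
qed

lemma finite_PF_shuffle: "finite (PF_shuffle a b r s)"
  unfolding PF_shuffle_def using finite_parking_functions by simp

definition q_int :: "'a::field \<Rightarrow> nat \<Rightarrow> 'a" where
  "q_int q m = (\<Sum>i<m. q ^ i)"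

definition q_fact :: "'a::field \<Rightarrow> nat \<Rightarrow> 'a" where
  "q_fact q m = (\<Prod>i=1..m. q_int q i)"

definition q_binomial :: "'a::field \<Rightarrow> nat \<Rightarrow> nat \<Rightarrow> 'a" where
  "q_binomial q m k = (if k \<le> m then q_fact q m / (q_fact q k * q_fact q (m - k)) else 0)"

text \<open>
  The indeterminate \<open>q\<close>, in the field of fractions of the integer polynomials. By the lemma below,
  no \<open>q_int qq m\<close> with \<open>m > 0\<close> vanishes, so none of the quotients above is a division by zero.
\<close>

definition qq :: "int poly fract" where
  "qq = Fraction_Field.Fract [:0, 1:] 1"

lemma q_int_qq_nonzero:
  assumes "m > 0"
  shows "q_int qq m \<noteq> 0"
proof -
  have pow: "qq ^ i = Fraction_Field.Fract (monom 1 i) 1" for i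
    by (induction i) (auto simp: qq_def One_fract_def monom_Suc)
  have "q_int qq k = Fraction_Field.Fract (\<Sum>i<k. monom 1 i) 1" for k
    by (induction k) (auto simp: q_int_def pow Zero_fract_def)
  moreover have "coeff (\<Sum>i<m. monom (1 :: int) i) 0 = 1"
    using assms by (simp add: coeff_sum)
  then have "(\<Sum>i<m. monom (1 :: int) i) \<noteq> 0"
    by (metis coeff_0 zero_neq_one)
  ultimately show ?thesis
    by (simp add: Zero_fract_def eq_fract)
qed

end

theory Submission
  imports Defs
begin

text \<open>
  Because each of the two words is read in increasing order, \<open>u\<^sub>i = u\<^sub>i\<^sub>-\<^sub>1 + 1\<close> forces a small car in row
  \<open>i - 1\<close> and a big one in row \<open>i\<close>. Hence \<open>g\<^sub>i = 2 u\<^sub>i + 1\<close> for small and \<open>g\<^sub>i = 2 u\<^sub>i\<close> for big cars turns the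
  parking functions in question into all sequences with \<open>g\<^sub>i \<le> g\<^sub>i\<^sub>-\<^sub>1 + 1\<close> (and \<open>g\<^sub>0 = 0\<close> prepended), with
  area \<open>\<Sum> \<lfloor>g\<^sub>i / 2\<rfloor>\<close> and with dinv the number of pairs \<open>i < j\<close> such that \<open>g\<^sub>i = g\<^sub>j + 1\<close>. The zeros of such a
  sequence can be distributed freely among its ones, which contributes a \<open>q\<close>-binomial coefficient. Deleting
  the zeros and lowering all other entries by one swaps the roles of \<open>a\<close> and \<open>b\<close>. The closed form
  satisfies the resulting recursion by the \<open>q\<close>-Vandermonde identity.
\<close>

subsection \<open>Gaussian binomial coefficients\<close>

lemma q_int_Suc: "q_int q (Suc m) = q_int q m + q ^ m"
  by (simp add: q_int_def)

lemma q_int_0 [simp]: "q_int q 0 = 0"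
  by (simp add: q_int_def)

lemma q_int_add: "q_int q (m + n) = q_int q m + q ^ m * q_int q n"
  by (induction n) (auto simp: q_int_Suc algebra_simps power_add)

lemma q_fact_0 [simp]: "q_fact q 0 = 1"
  by (simp add: q_fact_def)

lemma q_fact_Suc: "q_fact q (Suc m) = q_fact q m * q_int q (Suc m)"
  by (simp add: q_fact_def)

text \<open>The identities below cancel q-integers and use negative powers of \<open>q\<close>; the
  two assumptions make this legitimate. The indeterminate \<open>qq\<close> is shown to meet them
  later.\<close>

locale generic_q =
  fixes q :: "'a::field"
  assumes q_nz: "q \<noteq> 0"
    and q_int_nz: "\<And>m. m > 0 \<Longrightarrow> q_int q m \<noteq> 0"
begin

lemma q_fact_nz: "q_fact q m \<noteq> 0"
  using q_int_nz by (simp add: q_fact_def)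

lemma q_binomial_0: "q_binomial q m 0 = 1"
  using q_fact_nz by (simp add: q_binomial_def)

lemma q_binomial_self: "q_binomial q m m = 1"
  using q_fact_nz by (simp add: q_binomial_def)

lemma q_binomial_sym: "q_binomial q (m + k) m = q_binomial q (m + k) k"
  by (simp add: q_binomial_def mult.commute)

text \<open>The q-integer of a sum splits as \<open>[s+1] + q^(s+1) [r+1]\<close>, or with the two
  summands exchanged; the two splittings give the two Pascal rules. Tops are written as sums to
  avoid truncated subtraction.\<close>

lemma q_pascal:
  "q_binomial q (Suc r + Suc s) (Suc s) =
     q_binomial q (Suc r + s) s + q ^ Suc s * q_binomial q (r + Suc s) (Suc s)"
proof -
  have "q_int q (Suc r + Suc s) = q_int q (Suc s) + q ^ Suc s * q_int q (Suc r)"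
    by (metis q_int_add add.commute)
  then show ?thesis
    using q_fact_nz[of r] q_fact_nz[of s] q_int_nz[of "Suc r"] q_int_nz[of "Suc s"]
    by (simp add: q_binomial_def q_fact_Suc field_simps)
qed

lemma q_pascal':
  "q_binomial q (Suc r + Suc s) (Suc s) =
     q ^ Suc r * q_binomial q (Suc r + s) s + q_binomial q (r + Suc s) (Suc s)"
proof -
  have "q_int q (Suc r + Suc s) = q_int q (Suc r) + q ^ Suc r * q_int q (Suc s)"
    by (metis q_int_add)
  then show ?thesis
    using q_fact_nz[of r] q_fact_nz[of s] q_int_nz[of "Suc r"] q_int_nz[of "Suc s"]
    by (simp add: q_binomial_def q_fact_Suc field_simps)
qed

text \<open>Behind this is the product of the series \<open>1 / prod (1 - x q^i)\<close> over
  \<open>i = 0..c\<close> and over \<open>i = c+1..c+r+1\<close>: the coefficient of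
  \<open>x^M\<close> is compared. The proof avoids series and uses a double induction with
  \<open>q_pascal'\<close>.\<close>

lemma q_vandermonde:
  "(\<Sum>j\<le>M. q ^ (j * Suc c) * q_binomial q (r + j) j * q_binomial q (c + (M - j)) (M - j)) =
     q_binomial q (Suc c + r + M) M"
proof (induction r arbitrary: M)
  case 0
  have "(\<Sum>j\<le>M. q ^ (j * Suc c) * q_binomial q (c + (M - j)) (M - j)) =
     q_binomial q (Suc c + M) M"
  proof (induction M)
    case (Suc M)
    have "(\<Sum>j\<le>Suc M. q ^ (j * Suc c) * q_binomial q (c + (Suc M - j)) (Suc M - j)) =
      q_binomial q (c + Suc M) (Suc M) +
      q ^ Suc c * (\<Sum>j\<le>M. q ^ (j * Suc c) * q_binomial q (c + (M - j)) (M - j))"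
      by (subst sum.atMost_Suc_shift) (simp add: sum_distrib_left power_add mult_ac)
    with Suc show ?case using q_pascal'[of c M] by simp
  qed (simp add: q_binomial_0)
  then show ?case by (simp add: q_binomial_self)
next
  case (Suc r)
  note IH = Suc
  show ?case
  proof (induction M)
    case (Suc M)
    let ?t = "\<lambda>r M j. q ^ (j * Suc c) * q_binomial q (r + j) j * q_binomial q (c + (M - j)) (M - j)"
    \<comment> \<open>The Pascal rule splits a term into one with smaller \<open>M\<close> and one
      with smaller \<open>r\<close>, so both induction hypotheses apply after summation.\<close>
    have t: "?t (Suc r) (Suc M) (Suc j) =
      q ^ Suc (Suc c + r) * ?t (Suc r) M j + ?t r (Suc M) (Suc j)" if "j \<le> M" for j
      using q_pascal'[of r j] that by (simp add: algebra_simps power_add)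
    have "(\<Sum>j\<le>Suc M. ?t (Suc r) (Suc M) j) =
      ?t r (Suc M) 0 + (\<Sum>j\<le>M. ?t (Suc r) (Suc M) (Suc j))"
      by (subst sum.atMost_Suc_shift) (simp add: q_binomial_0)
    also have "(\<Sum>j\<le>M. ?t (Suc r) (Suc M) (Suc j)) =
      q ^ Suc (Suc c + r) * (\<Sum>j\<le>M. ?t (Suc r) M j) + (\<Sum>j\<le>M. ?t r (Suc M) (Suc j))"
      using t by (simp add: sum.distrib sum_distrib_left)
    also have "?t r (Suc M) 0 + (q ^ Suc (Suc c + r) * (\<Sum>j\<le>M. ?t (Suc r) M j) +
        (\<Sum>j\<le>M. ?t r (Suc M) (Suc j))) =
      (\<Sum>j\<le>Suc M. ?t r (Suc M) j) + q ^ Suc (Suc c + r) * (\<Sum>j\<le>M. ?t (Suc r) M j)"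
      by (subst sum.atMost_Suc_shift) (simp del: mult_Suc_right)
    also have "\<dots> = q_binomial q (Suc c + Suc r + Suc M) (Suc M)"
      using q_pascal'[of "Suc c + r" M] by (simp only: IH Suc) (simp add: add_ac)
    finally show ?case .
  qed (simp add: q_binomial_0)
qed

lemma q_binomial_add: "q_binomial q (m + k) m = q_fact q (m + k) / (q_fact q m * q_fact q k)"
  by (simp add: q_binomial_def)

text \<open>Both sides are \<open>[r+j+1]! / ([r]! [j]!)\<close>.\<close>

lemma q_binomial_absorb:
  "q_binomial q (Suc j + r) r * q_int q (Suc j) = q_int q (Suc r) * q_binomial q (Suc r + j) j"
proof -
  have *: "q_binomial q (Suc j + r) r = q_fact q (Suc (j + r)) / (q_fact q r * q_fact q (Suc j))"
    "q_binomial q (Suc r + j) j = q_fact q (Suc (j + r)) / (q_fact q j * q_fact q (Suc r))"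
    using q_binomial_add[of r "Suc j"] q_binomial_add[of j "Suc r"] by (simp_all add: add_ac)
  show ?thesis unfolding *
    using q_fact_nz[of r] q_fact_nz[of j] q_int_nz[of "Suc j"] q_int_nz[of "Suc r"]
    by (simp add: q_fact_Suc[of q r] q_fact_Suc[of q j] field_simps)
qed

text \<open>Both sides are \<open>[c+m]! / ([m]! [c+1]!)\<close>. This trades a denominator
  depending on \<open>m\<close> for one that does not.\<close>

lemma q_binomial_div_absorb:
  "q_binomial q (m + Suc c) m / q_int q (m + Suc c) = q_binomial q (c + m) m / q_int q (Suc c)"
proof -
  have *: "q_binomial q (m + Suc c) m = q_fact q (Suc (c + m)) / (q_fact q m * q_fact q (Suc c))"
    "q_binomial q (c + m) m = q_fact q (c + m) / (q_fact q m * q_fact q c)"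
    using q_binomial_add[of m "Suc c"] q_binomial_add[of m c] by (simp_all add: add_ac)
  show ?thesis unfolding *
    using q_fact_nz[of m] q_fact_nz[of c] q_int_nz[of "Suc (c + m)"] q_int_nz[of "Suc c"]
    by (simp add: q_fact_Suc[of q c] q_fact_Suc[of q "c + m"] field_simps)
qed

end

subsection \<open>Paths and their generating function\<close>

fun small_steps :: "nat \<Rightarrow> nat list \<Rightarrow> bool" where
  "small_steps p [] = True"
| "small_steps p (x # xs) = (x \<le> Suc p \<and> small_steps x xs)"

fun unit_drops :: "nat list \<Rightarrow> nat" where
  "unit_drops [] = 0"
| "unit_drops (x # xs) = length (filter (\<lambda>y. x = Suc y) xs) + unit_drops xs"

definition half_sum :: "nat list \<Rightarrow> nat" where
  "half_sum l = (\<Sum>x\<leftarrow>l. x div 2)"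

text \<open>Odd entries stand for small cars and even ones for big cars; ones and zeros are those of
  them on the main diagonal.\<close>

definition paths :: "nat \<Rightarrow> nat \<Rightarrow> nat \<Rightarrow> nat \<Rightarrow> nat list set" where
  "paths s r a b = {l. small_steps 0 l \<and> count_list l 0 = s \<and> count_list l 1 = r \<and>
     length (filter odd l) = a \<and> length (filter even l) = b}"

lemma small_steps_le: "small_steps p l \<Longrightarrow> x \<in> set l \<Longrightarrow> x \<le> p + length l"
  by (induction p l rule: small_steps.induct) fastforce+

lemma finite_paths: "finite (paths s r a b)"
proof (rule finite_subset)
  show "paths s r a b \<subseteq> {l. set l \<subseteq> {..a + b} \<and> length l = a + b}"
  proof clarify
    fix l assume l: "l \<in> paths s r a b"
    then have "length l = a + b"
      using sum_length_filter_compl[of odd l] by (simp add: paths_def)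
    with l small_steps_le[of 0 l] show "set l \<subseteq> {..a + b} \<and> length l = a + b"
      by (auto simp: paths_def)
  qed
qed (simp add: finite_lists_length_eq)

text \<open>
  A run of zeros can only stand directly before a one or at the end, so the zeros and ones of the result
  determine it: they form an arbitrary word.
\<close>

definition zero_insertions :: "nat \<Rightarrow> nat list \<Rightarrow> nat \<Rightarrow> nat list set" where
  "zero_insertions p m s =
     {l. small_steps p l \<and> filter (\<lambda>x. x \<noteq> 0) l = m \<and> count_list l 0 = s}"

fun one_zero_pairs :: "nat list \<Rightarrow> nat" where
  "one_zero_pairs [] = 0"
| "one_zero_pairs (x # xs) = (if x = 1 then count_list xs 0 else 0) + one_zero_pairs xs"

text \<open>A unit drop that involves a zero must go from a one down to that zero; all other unit
  drops survive the deletion of zeros.\<close>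

lemma unit_drops_split:
  "unit_drops l = unit_drops (filter (\<lambda>x. x \<noteq> 0) l) + one_zero_pairs l"
proof (induction l)
  case (Cons x l)
  have "length (filter (\<lambda>y. x = Suc y) l) =
    length (filter (\<lambda>y. x = Suc y) (filter (\<lambda>x. x \<noteq> 0) l)) + (if x = 1 then count_list l 0 else 0)"
    by (induction l) (auto simp del: filter_filter)
  with Cons show ?case by (auto simp: filter_empty_conv)
qed simp

text \<open>The first nonzero entry after a zero is forced to be one, and a one may follow
  anything.\<close>

lemma small_steps_filter_nonzero:
  "small_steps p l \<Longrightarrow> small_steps p (filter (\<lambda>x. x \<noteq> 0) l)"
proof (induction l arbitrary: p)
  case (Cons x l)
  show ?case
  proof (cases "x = 0")
    case True
    with Cons have "small_steps 0 (filter (\<lambda>x. x \<noteq> 0) l)" by auto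
    with True show ?thesis by (cases "filter (\<lambda>x. x \<noteq> 0) l") auto
  next
    case False
    with Cons show ?thesis by auto
  qed
qed simp

lemma zero_insertions_Nil: "zero_insertions p [] s = {replicate s 0}"
proof -
  have "small_steps p (replicate s 0)" for p
    by (induction s arbitrary: p) auto
  moreover have "count_list (replicate s (0::nat)) 0 = s" by (induction s) auto
  moreover have "l = replicate (count_list l 0) 0" if "filter (\<lambda>x. x \<noteq> (0::nat)) l = []" for l
    using that by (induction l) (auto split: if_splits)
  ultimately show ?thesis by (auto simp: zero_insertions_def)
qed

lemma zero_insertions_Cons:
  assumes "x \<noteq> 0" "x \<le> Suc p"
  shows "zero_insertions p (x # m) s = (#) x ` zero_insertions x m s \<union>
     (if x = 1 \<and> s > 0 then (#) 0 ` zero_insertions 0 (x # m) (s - 1) else {})" (is "?L = ?R")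
proof
  show "?L \<subseteq> ?R"
  proof
    fix l assume "l \<in> ?L"
    then have l: "small_steps p l" "filter (\<lambda>x. x \<noteq> 0) l = x # m" "count_list l 0 = s"
      by (auto simp: zero_insertions_def)
    then obtain y l' where yl: "l = y # l'" by (cases l) auto
    show "l \<in> ?R"
    proof (cases "y = 0")
      case True
      \<comment> \<open>A leading zero resets the bound, so the first nonzero entry \<open>x\<close>
        can only be one.\<close>
      then have "small_steps 0 (x # m)"
        using l yl small_steps_filter_nonzero[of 0 l'] by simp
      then have "x = 1" using assms by auto
      then show ?thesis using l yl True by (auto simp: zero_insertions_def image_iff)
    next
      case False
      then show ?thesis using l yl by (auto simp: zero_insertions_def image_iff)
    qed
  qed
  show "?R \<subseteq> ?L" using assms by (auto simp: zero_insertions_def split: if_splits)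
qed

lemma length_nonzero: "length l = length (filter (\<lambda>x. x \<noteq> (0::nat)) l) + count_list l 0"
  by (induction l) auto

lemma finite_zero_insertions: "finite (zero_insertions p m s)"
proof (rule finite_subset)
  show "zero_insertions p m s \<subseteq>
    {l. set l \<subseteq> {..p + (length m + s)} \<and> length l = length m + s}"
  proof clarify
    fix l assume l: "l \<in> zero_insertions p m s"
    then have "length l = length m + s"
      using length_nonzero[of l] by (auto simp: zero_insertions_def)
    with l small_steps_le[of p l]
    show "set l \<subseteq> {..p + (length m + s)} \<and> length l = length m + s"
      by (auto simp: zero_insertions_def)
  qed
qed (simp add: finite_lists_length_eq)

section \<open>Summation over paths: inserted zeros, recursion, closed form\<close>

context generic_q
begin

text \<open>The zeros and ones form an arbitrary word, and \<open>one_zero_pairs\<close> counts its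
  inversions, whose generating function is a q-binomial coefficient. A leading one contributes
  \<open>q^s\<close> and a leading zero nothing, which is \<open>q_pascal\<close>.\<close>

lemma zero_insertions_sum:
  "small_steps p m \<Longrightarrow> 0 \<notin> set m \<Longrightarrow>
     (\<Sum>l\<in>zero_insertions p m s. q ^ one_zero_pairs l) =
       q_binomial q (count_list m 1 + s) s"
proof (induction m arbitrary: p s)
  case Nil
  have "one_zero_pairs (replicate s 0) = 0" by (induction s) auto
  then show ?case by (simp add: zero_insertions_Nil q_binomial_self)
next
  case (Cons x m)
  note IH = Cons.IH and prems = Cons.prems
  have x: "x \<noteq> 0" "x \<le> Suc p" "small_steps x m" "0 \<notin> set m" using prems by auto
  have head: "(\<Sum>l\<in>(#) x ` zero_insertions x m s. q ^ one_zero_pairs l) =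
    (if x = 1 then q ^ s else 1) * q_binomial q (count_list m 1 + s) s" for s
  proof -
    have "(\<Sum>l\<in>(#) x ` zero_insertions x m s. q ^ one_zero_pairs l) =
      (\<Sum>l\<in>zero_insertions x m s. (if x = 1 then q ^ s else 1) * q ^ one_zero_pairs l)"
      unfolding sum.reindex[OF inj_on_Cons1] by (rule sum.cong) (auto simp: zero_insertions_def power_add)
    then show ?thesis using IH[OF x(3,4), of s] by (simp only: sum_distrib_left[symmetric])
  qed
  have disj: "(#) x ` zero_insertions x m s \<inter> (#) 0 ` Y = {}" for s Y using x by auto
  show ?case
  proof (cases "x = 1")
    case False
    then show ?thesis using head[of s] x by (simp add: zero_insertions_Cons)
  next
    case True
    show ?thesis using x(2)
    \<comment> \<open>A leading zero leaves \<open>x # m\<close> intact and only lowers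
      \<open>s\<close>, so the outer induction on the list does not cover it. The bound
      \<open>p\<close> then becomes 0, which still admits \<open>x = 1\<close>.\<close>
    proof (induction s arbitrary: p)
      case 0
      then show ?case using head[of 0] True by (simp add: zero_insertions_Cons q_binomial_0)
    next
      case (Suc s)
      have "(\<Sum>l\<in>(#) 0 ` zero_insertions 0 (x # m) s. q ^ one_zero_pairs l) =
        q_binomial q (count_list (x # m) 1 + s) s"
        using Suc.IH[of 0] True by (simp add: sum.reindex)
      then have "(\<Sum>l\<in>zero_insertions p (x # m) (Suc s). q ^ one_zero_pairs l) =
        q ^ Suc s * q_binomial q (count_list m 1 + Suc s) (Suc s) +
        q_binomial q (count_list (x # m) 1 + s) s"
        using head[of "Suc s"] True Suc.prems disj
        by (simp add: zero_insertions_Cons sum.union_disjoint finite_zero_insertions del: power_Suc)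
      then show ?case using q_pascal[of "count_list m 1" s] True by (simp add: add_ac)
    qed
  qed
qed


text \<open>The exponent is dinv minus area and may be negative; the constant
  \<open>(a + b) choose 2\<close> is restored in \<open>PF_sum_eq_path_sum\<close>.\<close>

definition weight :: "nat list \<Rightarrow> 'a" where
  "weight l = q powi (int (unit_drops l) - int (half_sum l))"

definition path_sum :: "nat \<Rightarrow> nat \<Rightarrow> nat \<Rightarrow> nat \<Rightarrow> 'a" where
  "path_sum s r a b = (\<Sum>l\<in>paths s r a b. weight l)"

text \<open>Zeros add nothing to \<open>half_sum\<close>, and the factor from inserting them depends
  on the remaining path only through its number \<open>r\<close> of ones. Zeros are even, so
  \<open>s\<close> of the \<open>b\<close> even entries disappear.\<close>

lemma path_sum_zeros:
  assumes "s \<le> b"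
  shows "path_sum s r a b = q_binomial q (r + s) s * path_sum 0 r a (b - s)"
proof -
  have half_sum: "half_sum (filter (\<lambda>x. x \<noteq> 0) l) = half_sum l" for l
    by (induction l) (auto simp: half_sum_def)
  have cnt: "count_list (filter (\<lambda>x. x \<noteq> 0) l) (Suc 0) = count_list l (Suc 0)"
    "count_list (filter (\<lambda>x. x \<noteq> 0) l) 0 = 0"
    "length (filter odd (filter (\<lambda>x. x \<noteq> 0) l)) = length (filter odd l)"
    "length (filter even (filter (\<lambda>x. x \<noteq> 0) l)) + count_list l 0 = length (filter even l)" for l :: "nat list"
    by (induction l) (auto simp del: filter_filter)
  have union: "paths s r a b = (\<Union>m\<in>paths 0 r a (b - s). zero_insertions 0 m s)"
  proof (intro equalityI subsetI)
    fix l assume "l \<in> paths s r a b"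
    then have "filter (\<lambda>x. x \<noteq> 0) l \<in> paths 0 r a (b - s)" "l \<in> zero_insertions 0 (filter (\<lambda>x. x \<noteq> 0) l) s"
      using cnt[of l] small_steps_filter_nonzero[of 0 l]
      by (auto simp: paths_def zero_insertions_def simp del: filter_filter)
    then show "l \<in> (\<Union>m\<in>paths 0 r a (b - s). zero_insertions 0 m s)" by blast
  next
    fix l assume "l \<in> (\<Union>m\<in>paths 0 r a (b - s). zero_insertions 0 m s)"
    then show "l \<in> paths s r a b"
      using cnt[of l] assms by (auto simp: paths_def zero_insertions_def simp del: filter_filter)
  qed
  have "path_sum s r a b = (\<Sum>m\<in>paths 0 r a (b - s). \<Sum>l\<in>zero_insertions 0 m s. weight l)"
    unfolding path_sum_def union
    by (rule sum.UNION_disjoint)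
      (auto simp: finite_paths finite_zero_insertions, auto simp: zero_insertions_def)
  also have "\<dots> = (\<Sum>m\<in>paths 0 r a (b - s). q_binomial q (r + s) s * weight m)"
  proof (rule sum.cong)
    fix m assume m: "m \<in> paths 0 r a (b - s)"
    have "weight l = weight m * q ^ one_zero_pairs l" if "l \<in> zero_insertions 0 m s" for l
    proof -
      have "unit_drops l = unit_drops m + one_zero_pairs l" "half_sum l = half_sum m"
        using that unit_drops_split[of l] half_sum[of l] by (auto simp: zero_insertions_def)
      then have "int (unit_drops l) - int (half_sum l) =
        (int (unit_drops m) - int (half_sum m)) + int (one_zero_pairs l)"
        by simp
      then show ?thesis
        unfolding weight_def by (simp only: power_int_add[OF disjI1[OF q_nz]] power_int_of_nat)
    qed
    then show "(\<Sum>l\<in>zero_insertions 0 m s. weight l) = q_binomial q (r + s) s * weight m"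
      using zero_insertions_sum[of 0 m s] m count_list_0_iff[of m 0]
      by (simp add: paths_def flip: sum_distrib_left)
  qed simp
  finally show ?thesis by (simp add: path_sum_def sum_distrib_left)
qed

text \<open>A nonempty path without zeros starts with a one, which no unit drop leaves. Removing it
  and lowering the rest by one exchanges parities, turns the other \<open>r\<close> ones into zeros
  and the twos into ones, whose number \<open>k\<close> is free.\<close>

lemma path_sum_shift:
  "path_sum 0 (Suc r) (Suc a) b = q powi (- int b) * (\<Sum>k\<le>b. path_sum r k b a)"
proof -
  let ?f = "\<lambda>l. 1 # map Suc l"
  have steps: "small_steps (Suc p) (map Suc l) = small_steps p l" for p l
    by (induction l arbitrary: p) auto
  have cnt: "count_list (map Suc l) 0 = 0" "count_list (map Suc l) (Suc 0) = count_list l 0"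
    "length (filter odd (map Suc l)) = length (filter even l)"
    "length (filter even (map Suc l)) = length (filter odd l)"
    "count_list l 1 \<le> length (filter odd l)" for l
    by (induction l) auto
  have eq: "paths 0 (Suc r) (Suc a) b = ?f ` (\<Union>k\<le>b. paths r k b a)"
  proof (intro equalityI subsetI)
    fix l assume l: "l \<in> paths 0 (Suc r) (Suc a) b"
    then obtain x m where xm: "l = x # m" "x = 1" by (cases l) (auto simp: paths_def split: if_splits)
    have "0 \<notin> set m" using l xm by (auto simp: paths_def count_list_0_iff)
    then have "m = map Suc (map (\<lambda>x. x - 1) m)" by (induction m) auto
    then obtain m' where "m = map Suc m'" by blast
    then have "l = ?f m'" "m' \<in> paths r (count_list m' 1) b a" "count_list m' 1 \<le> b"
      using l xm cnt[of m'] steps[of 0 m'] by (auto simp: paths_def)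
    then show "l \<in> ?f ` (\<Union>k\<le>b. paths r k b a)" by blast
  next
    fix l assume "l \<in> ?f ` (\<Union>k\<le>b. paths r k b a)"
    then show "l \<in> paths 0 (Suc r) (Suc a) b"
      using cnt steps[of 0] by (auto simp: paths_def)
  qed
  have inj: "inj_on ?f X" for X by (auto simp: inj_on_def)
  have drops: "unit_drops (?f l) = unit_drops l" for l
    by (induction l) (auto simp: filter_map comp_def)
  \<comment> \<open>Raising an entry by one changes its half exactly when the entry is odd; there
    are \<open>b\<close> such entries, hence the factor \<open>q powi (- int b)\<close>.\<close>
  have half: "half_sum (?f l) = half_sum l + length (filter odd l)" for l
  proof (induction l)
    case (Cons x l)
    then show ?case by (cases "even x") (auto simp: half_sum_def elim!: oddE)
  qed (simp add: half_sum_def)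
  have w: "weight (?f l) = q powi (- int b) * weight l" if "l \<in> (\<Union>k\<le>b. paths r k b a)" for l
  proof -
    have "int (unit_drops l) - int (half_sum l + length (filter odd l)) =
      - int b + (int (unit_drops l) - int (half_sum l))"
      using that by (auto simp: paths_def)
    then show ?thesis
      unfolding weight_def drops half by (simp only: power_int_add[OF disjI1[OF q_nz]])
  qed
  have "path_sum 0 (Suc r) (Suc a) b = (\<Sum>l\<in>(\<Union>k\<le>b. paths r k b a). q powi (- int b) * weight l)"
    unfolding path_sum_def eq sum.reindex[OF inj] using w by simp
  also have "\<dots> = q powi (- int b) * (\<Sum>k\<le>b. path_sum r k b a)"
    unfolding path_sum_def sum_distrib_left[symmetric]
    by (subst sum.UNION_disjoint) (auto simp: finite_paths, auto simp: paths_def)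
  finally show ?thesis .
qed

text \<open>The shift produces \<open>r\<close> zeros, which \<open>path_sum_zeros\<close> removes.
  The form \<open>b - k + k\<close> matches the pattern \<open>c + r\<close> of
  \<open>path_sum_closed\<close>.\<close>

lemma path_sum_rec:
  "path_sum 0 (Suc r) (c + Suc r) b =
     q powi (- int b) * (\<Sum>k\<le>b. q_binomial q (k + r) r * path_sum 0 k (b - k + k) c)"
proof -
  have "path_sum r k b (c + r) = q_binomial q (k + r) r * path_sum 0 k (b - k + k) c"
    if "k \<le> b" for k
    using path_sum_zeros[of r "c + r" k b] that by simp
  then show ?thesis
    using path_sum_shift[of r "c + r" b] by simp
qed

lemma path_sum_empty: "path_sum 0 0 a b = (if a = 0 \<and> b = 0 then 1 else 0)"
proof -
  have "paths 0 0 a b = (if a = 0 \<and> b = 0 then {[]} else {})"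
  proof -
    have "l = []" if "l \<in> paths 0 0 a b" for l
    proof (cases l)
      case (Cons x m)
      then have "x = 0 \<or> x = 1" "0 \<notin> set l" "1 \<notin> set l"
        using that by (auto simp: paths_def count_list_0_iff)
      then show ?thesis using Cons by auto
    qed simp
    moreover have "[] \<in> paths 0 0 a b \<longleftrightarrow> a = 0 \<and> b = 0"
      by (auto simp: paths_def)
    ultimately show ?thesis by (auto split: if_splits)
  qed
  then show ?thesis by (simp add: path_sum_def weight_def half_sum_def)
qed

text \<open>Induction on the length of the paths through \<open>path_sum_rec\<close>. For
  \<open>b = 0\<close> only the all-one path remains; this case is separate because for
  \<open>c = 0\<close> the general quotient is \<open>0 / 0\<close>, which evaluates to 0 instead of
  1.\<close>

lemma path_sum_closed:
  "path_sum 0 r (c + r) b = (if b = 0 then if c = 0 then 1 else 0 else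
     q powi (- int (Suc c * b)) * q_binomial q (c + r + b - 1) (c + r) * q_binomial q (c + b) c *
       (q_int q r / q_int q (c + b)))"
proof (induction "c + r + b" arbitrary: r c b rule: less_induct)
  case less
  show ?case
  proof (cases r)
    case 0
    then show ?thesis by (auto simp: path_sum_empty)
  next
    case r: (Suc r')
    have rec: "path_sum 0 r (c + r) b =
      q powi (- int b) * (\<Sum>k\<le>b. q_binomial q (k + r') r' * path_sum 0 k (b - k + k) c)"
      unfolding r by (rule path_sum_rec)
    \<comment> \<open>The hypothesis is used with \<open>b - k\<close> for \<open>c\<close> and
      \<open>c\<close> for \<open>b\<close>; the length drops from \<open>c + r + b\<close> to
      \<open>b + c\<close> because \<open>r > 0\<close>.\<close>
    have IH: "path_sum 0 k (b - k + k) c = (if c = 0 then if b - k = 0 then 1 else 0 else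
      q powi (- int (Suc (b - k) * c)) * q_binomial q (b + c - 1) b *
        q_binomial q (b - k + c) (b - k) * (q_int q k / q_int q (b - k + c)))" if "k \<le> b" for k
      using less[of "b - k" k c] that r by simp
    show ?thesis
    proof (cases c)
      case c: 0
      have "(\<Sum>k\<le>b. q_binomial q (k + r') r' * path_sum 0 k (b - k + k) c) =
        (\<Sum>k\<le>b. if k = b then q_binomial q (b + r') r' else 0)"
        using c IH by (intro sum.cong) auto
      then have *: "path_sum 0 r (c + r) b = q powi (- int b) * q_binomial q (b + r') r'"
        unfolding rec by simp
      show ?thesis
      proof (cases b)
        case 0
        then show ?thesis using * c by (simp add: q_binomial_self)
      next
        case b: (Suc b')
        have "q_binomial q (b + r') r' = q_binomial q (r + b') r * (q_int q r / q_int q b)"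
          using b r q_binomial_absorb[of b' r'] q_int_nz[of b] q_binomial_sym[of r b']
          by (simp add: field_simps)
        then show ?thesis using * c b by (simp add: q_binomial_0)
      qed
    next
      case c: (Suc c')
      show ?thesis
      proof (cases b)
        case 0
        then show ?thesis unfolding rec by (simp add: c path_sum_empty)
      next
        case b: (Suc b')
        \<comment> \<open>With \<open>k = j + 1\<close> (the term \<open>k = 0\<close> vanishes),
          \<open>?K\<close> collects the factors free of \<open>j\<close> and \<open>?v\<close> is
          the summand of \<open>q_vandermonde\<close>.\<close>
        let ?K = "q powi (- int (b * c)) * (q_int q r * q_binomial q (c' + b) b / q_int q c)"
        let ?v = "\<lambda>j. q ^ (j * c) * q_binomial q (r + j) j * q_binomial q (c' + (b' - j)) (b' - j)"
        have term_eq: "q_binomial q (Suc j + r') r' * path_sum 0 (Suc j) (b - Suc j + Suc j) c = ?K * ?v j"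
          if j: "j \<le> b'" for j
        proof -
          obtain m where m: "b' = j + m" using le_Suc_ex[OF j] by blast
          have e: "q powi (- int (Suc m * c)) = q powi (- int (b * c)) * q ^ (j * c)"
          proof -
            have "- int (Suc m * c) = - int (b * c) + int (j * c)"
              unfolding b m by (simp add: algebra_simps)
            then show ?thesis by (simp only: power_int_add[OF disjI1[OF q_nz]] power_int_of_nat)
          qed
          have "path_sum 0 (Suc j) (b - Suc j + Suc j) c =
            q powi (- int (Suc m * c)) * q_binomial q (c' + b) b *
              (q_binomial q (m + c) m / q_int q (m + c)) * q_int q (Suc j)"
            using IH[of "Suc j"] b m c by (simp add: add_ac)
          \<comment> \<open>The denominator \<open>q_int q (m + c)\<close> varies with
            \<open>j\<close> and has to go; afterwards \<open>q_binomial_absorb\<close> likewise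
            turns the factor \<open>q_int q (Suc j)\<close> into the constant
            \<open>q_int q r\<close>.\<close>
          also have "\<dots> = (q powi (- int (b * c)) * q ^ (j * c)) * q_binomial q (c' + b) b *
              (q_binomial q (c' + m) m / q_int q c) * q_int q (Suc j)"
            using q_binomial_div_absorb[of m c'] unfolding e by (simp only: c)
          finally have "q_binomial q (Suc j + r') r' * path_sum 0 (Suc j) (b - Suc j + Suc j) c =
            (q_binomial q (Suc j + r') r' * q_int q (Suc j)) *
            ((q powi (- int (b * c)) * q ^ (j * c)) * q_binomial q (c' + b) b *
              (q_binomial q (c' + m) m / q_int q c))"
            by (simp only: mult_ac)
          then show ?thesis
            unfolding q_binomial_absorb r[symmetric] by (simp add: m)
        qed
        have "(\<Sum>k\<le>b. q_binomial q (k + r') r' * path_sum 0 k (b - k + k) c) =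
          (\<Sum>j\<le>b'. q_binomial q (Suc j + r') r' * path_sum 0 (Suc j) (b - Suc j + Suc j) c)"
          unfolding b sum.atMost_Suc_shift using path_sum_empty[of "Suc b'" c] c by simp
        also have "\<dots> = ?K * (\<Sum>j\<le>b'. ?v j)"
          unfolding sum_distrib_left using term_eq by (intro sum.cong) auto
        also have "(\<Sum>j\<le>b'. ?v j) = q_binomial q (c + r + b') (c + r)"
          using q_vandermonde[of c' r b'] q_binomial_sym[of "c + r" b'] c by simp
        finally have "path_sum 0 r (c + r) b =
          (q powi (- int b) * q powi (- int (b * c))) * q_binomial q (c + r + b') (c + r) *
            (q_int q r * (q_binomial q (c' + b) b / q_int q c))"
          unfolding rec by (simp add: mult_ac)
        also have "q powi (- int b) * q powi (- int (b * c)) = q powi (- int (Suc c * b))"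
        proof -
          have "- int (Suc c * b) = - int b + - int (b * c)" by (simp add: algebra_simps)
          then show ?thesis by (simp only: power_int_add[OF disjI1[OF q_nz]])
        qed
        also have "q_binomial q (c' + b) b / q_int q c = q_binomial q (c + b) c / q_int q (c + b)"
          using q_binomial_div_absorb[of b c'] q_binomial_sym[of c b] c by (simp add: add_ac)
        finally show ?thesis using b by simp
      qed
    qed
  qed
qed

end

subsection \<open>Parking functions as paths\<close>

lemma small_steps_iff_nth:
  "small_steps p l \<longleftrightarrow> (\<forall>i<length l. l ! i \<le> Suc ((p # l) ! i))"
  by (induction p l rule: small_steps.induct) (auto simp: All_less_Suc2)

lemma unit_drops_eq_card:
  "unit_drops l = card {(i, j). i < j \<and> j < length l \<and> l ! i = Suc (l ! j)}"
proof (induction l)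
  case (Cons x l)
  let ?S = "\<lambda>l. {(i, j). i < j \<and> j < length l \<and> l ! i = Suc (l ! j)}"
  have fin: "finite (?S l)" for l :: "nat list"
    by (rule finite_subset[of _ "{..<length l} \<times> {..<length l}"]) auto
  have "?S (x # l) = Pair 0 ` Suc ` {j. j < length l \<and> x = Suc (l ! j)} \<union> map_prod Suc Suc ` ?S l"
    (is "_ = ?A \<union> ?B")
  proof (intro equalityI subsetI)
    fix p assume "p \<in> ?S (x # l)"
    then show "p \<in> ?A \<union> ?B"
      by (cases p; cases "fst p"; cases "snd p") (auto simp: image_iff map_prod_def)
  qed auto
  moreover have "card (?A \<union> ?B) = card ?A + card ?B"
    using fin by (intro card_Un_disjoint) auto
  moreover have "card ?A = length (filter (\<lambda>y. x = Suc y) l)"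
    by (subst card_image, simp add: inj_on_def)+ (simp add: length_filter_conv_card)
  moreover have "card ?B = card (?S l)"
    by (intro card_image) (auto simp: inj_on_def)
  ultimately show ?case using Cons by simp
qed simp

section \<open>The order in which the diagonal word visits positions, independently of the
  cars\<close>

definition reads_before :: "nat list \<Rightarrow> nat \<Rightarrow> nat \<Rightarrow> bool" where
  "reads_before u i j \<longleftrightarrow> u ! j < u ! i \<or> u ! i = u ! j \<and> j < i"

definition reading_order :: "nat list \<Rightarrow> nat list" where
  "reading_order u =
     concat (map (\<lambda>d. filter (\<lambda>i. u ! i = d) (rev [0..<length u])) (rev [0..<length u]))"

lemma diagonal_word_eq: "diagonal_word (v, u) = map ((!) v) (reading_order u)"
  by (simp add: reading_order_def map_concat comp_def)

lemma sorted_wrt_rev_upt: "sorted_wrt (>) (rev [m..<n])"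
  by (simp add: sorted_wrt_rev)

lemma sorted_reading_order: "sorted_wrt (reads_before u) (reading_order u)"
proof -
  \<comment> \<open>Generalised from the two reversed intervals to arbitrary decreasing lists, so
    that induction on the list of diagonals is possible.\<close>
  have "sorted_wrt (reads_before u) (concat (map (\<lambda>d. filter (\<lambda>i. u ! i = d) xs) ds))"
    if "sorted_wrt (>) xs" "sorted_wrt (>) ds" for xs ds
    using that(2)
  proof (induction ds)
    case (Cons d ds)
    have "sorted_wrt (>) (filter (\<lambda>i. u ! i = d) xs)"
      using that(1) by (rule sorted_wrt_filter)
    then have "sorted_wrt (reads_before u) (filter (\<lambda>i. u ! i = d) xs)"
      by (rule sorted_wrt_mono_rel[rotated]) (auto simp: reads_before_def)
    moreover have "\<forall>i\<in>set (filter (\<lambda>i. u ! i = d) xs).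
      \<forall>j\<in>set (concat (map (\<lambda>d. filter (\<lambda>i. u ! i = d) xs) ds)). reads_before u i j"
      using Cons.prems by (auto simp: reads_before_def)
    ultimately show ?case using Cons by (simp add: sorted_wrt_append)
  qed simp
  then show ?thesis
    unfolding reading_order_def using sorted_wrt_rev_upt by blast
qed

lemma set_reading_order:
  assumes "\<And>i. i < length u \<Longrightarrow> u ! i < length u"
  shows "set (reading_order u) = {..<length u}"
  using assms by (auto simp: reading_order_def)

lemma reads_before_asym: "reads_before u i j \<Longrightarrow> \<not> reads_before u j i"
  by (auto simp: reads_before_def)

lemma distinct_if_sorted_wrt_asym:
  "sorted_wrt R xs \<Longrightarrow> (\<And>i j. R i j \<Longrightarrow> \<not> R j i) \<Longrightarrow> distinct xs"
  by (induction xs) auto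

text \<open>Since \<open>f\<close> maps the list onto an interval in order, comparing values of
  \<open>f\<close> means comparing places in the list, and these are ordered by
  \<open>R\<close>.\<close>

lemma less_iff_sorted_wrt:
  assumes "sorted_wrt R xs" "\<And>i j. R i j \<Longrightarrow> \<not> R j i" "map f xs = [c..<d]"
    and ij: "i \<in> set xs" "j \<in> set xs"
  shows "f i < f j \<longleftrightarrow> R i j"
proof -
  obtain x y where x: "x < length xs" "xs ! x = i" and y: "y < length xs" "xs ! y = j"
    using ij by (auto simp: in_set_conv_nth)
  have len: "length xs = d - c" using arg_cong[OF assms(3), of length] by simp
  have f: "f (xs ! k) = c + k" if "k < length xs" for k
    using that len nth_map[of k xs f] by (simp add: assms(3))
  consider "x < y" | "x = y" | "y < x" by linarith
  then show ?thesis
  proof cases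
    case 1
    then have "R i j" using assms(1) x y by (auto simp: sorted_wrt_iff_nth_less)
    then show ?thesis using f x y 1 by auto
  next
    case 2
    then show ?thesis using x y assms(2) by auto
  next
    case 3
    then have "R j i" using assms(1) x y by (auto simp: sorted_wrt_iff_nth_less)
    then show ?thesis using f x y 3 assms(2) by auto
  qed
qed

text \<open>The two words have disjoint alphabets, so a shuffle is recognised by its two
  restrictions.\<close>

lemma in_shuffles_upt_iff:
  "w \<in> shuffles [1..<a + 1] [a + 1..<a + b + 1] \<longleftrightarrow>
     filter (\<lambda>x. x \<le> a) w = [1..<a + 1] \<and> filter (\<lambda>x. \<not> x \<le> a) w = [a + 1..<a + b + 1]"
  (is "?L \<longleftrightarrow> ?R")
proof
  assume ?L
  moreover have "filter (\<lambda>x. x \<le> a) [1..<a + 1] = [1..<a + 1]"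
    "filter (\<lambda>x. \<not> x \<le> a) [a + 1..<a + b + 1] = [a + 1..<a + b + 1]"
    "filter (\<lambda>x. \<not> x \<le> a) [1..<a + 1] = []"
    "filter (\<lambda>x. x \<le> a) [a + 1..<a + b + 1] = []"
    by (auto simp: filter_id_conv filter_empty_conv simp del: upt_Suc)
  ultimately show ?R
    using imageI[of w _ "filter (\<lambda>x. x \<le> a)"] imageI[of w _ "filter (\<lambda>x. \<not> x \<le> a)"]
    by (metis filter_shuffles shuffles.simps singletonD)
next
  assume ?R
  then show ?L using partition_in_shuffles[of w "\<lambda>x. x \<le> a"] by metis
qed

text \<open>Provides the assignment of cars to positions in \<open>path_code_surj\<close>.\<close>

lemma ex_map_eq: "distinct xs \<Longrightarrow> length xs = length ys \<Longrightarrow> \<exists>f. map f xs = ys"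
proof (induction xs arbitrary: ys)
  case (Cons x xs)
  then obtain y zs where "ys = y # zs" by (cases ys) auto
  moreover from this Cons obtain f where "map f xs = zs" by fastforce
  ultimately have "map (f(x := y)) (x # xs) = ys" using Cons.prems by simp
  then show ?case by blast
qed simp

section \<open>The bijection between parking functions and paths\<close>

fun path_code :: "nat \<Rightarrow> two_line \<Rightarrow> nat list" where
  "path_code a (v, u) = map (\<lambda>i. 2 * u ! i + of_bool (v ! i \<le> a)) [0..<length u]"

lemma half_sum_path_code: "half_sum (path_code a (v, u)) = area (v, u)"
proof -
  have "map (\<lambda>i. (2 * u ! i + of_bool (v ! i \<le> a)) div 2) [0..<length u] = map ((!) u) [0..<length u]"
    by auto
  then show ?thesis by (simp add: half_sum_def comp_def map_nth)
qed

lemma count_path_code: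
  "count_list (path_code a (v, u)) 1 = small_on_diagonal a (v, u)"
  "count_list (path_code a (v, u)) 0 = big_on_diagonal a (v, u)"
proof -
  have "Suc 0 = 2 * x + of_bool P \<longleftrightarrow> x = 0 \<and> P" "0 = 2 * x + of_bool P \<longleftrightarrow> x = 0 \<and> \<not> P"
    for x P by auto
  then show "count_list (path_code a (v, u)) 1 = small_on_diagonal a (v, u)"
    "count_list (path_code a (v, u)) 0 = big_on_diagonal a (v, u)"
    by (simp_all add: count_list_eq_length_filter length_filter_conv_card not_le cong: conj_cong)
qed

lemma PF_shuffleD:
  assumes "(v, u) \<in> PF_shuffle a b r s"
  shows "length u = a + b" "length v = a + b" "distinct v" "set v = {1..a + b}"
    "\<And>i. i < a + b \<Longrightarrow> u ! i < a + b"
    "set (reading_order u) = {..<a + b}"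
    "map ((!) v) (filter (\<lambda>i. v ! i \<le> a) (reading_order u)) = [1..<a + 1]"
    "map ((!) v) (filter (\<lambda>i. \<not> v ! i \<le> a) (reading_order u)) = [a + 1..<a + b + 1]"
proof -
  have pf: "(v, u) \<in> parking_functions (a + b)"
    using assms by (simp add: PF_shuffle_def)
  then show len: "length u = a + b" "distinct v" "set v = {1..a + b}"
    by (auto simp: parking_functions_def permutations_of_set_def)
  then show "length v = a + b" using distinct_card[of v] by simp
  show u: "u ! i < a + b" if "i < a + b" for i
    using parking_functions_nth_le[OF pf that] that by simp
  then show "set (reading_order u) = {..<a + b}"
    using set_reading_order[of u] len by simp
  have "diagonal_word (v, u) \<in> shuffles [1..<a + 1] [a + 1..<a + b + 1]"
    using assms by (simp add: PF_shuffle_def del: diagonal_word.simps upt_Suc)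
  then show "map ((!) v) (filter (\<lambda>i. v ! i \<le> a) (reading_order u)) = [1..<a + 1]"
    "map ((!) v) (filter (\<lambda>i. \<not> v ! i \<le> a) (reading_order u)) = [a + 1..<a + b + 1]"
    unfolding diagonal_word_eq in_shuffles_upt_iff filter_map comp_def by blast+
qed

text \<open>The cars of one kind are read in increasing order, so the smaller of two such cars is
  the one read first.\<close>

lemma PF_shuffle_less_iff:
  assumes P: "(v, u) \<in> PF_shuffle a b r s" and "i < a + b" "j < a + b" "v ! i \<le> a \<longleftrightarrow> v ! j \<le> a"
  shows "v ! i < v ! j \<longleftrightarrow> reads_before u i j"
proof (cases "v ! i \<le> a")
  case True
  show ?thesis
    by (rule less_iff_sorted_wrt[OF sorted_wrt_filter[OF sorted_reading_order] reads_before_asym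
          PF_shuffleD(7)[OF P]])
      (use PF_shuffleD(6)[OF P] assms True in auto)
next
  case False
  show ?thesis
    by (rule less_iff_sorted_wrt[OF sorted_wrt_filter[OF sorted_reading_order] reads_before_asym
          PF_shuffleD(8)[OF P]])
      (use PF_shuffleD(6)[OF P] assms False in auto)
qed

lemma path_code_in_paths:
  assumes P: "(v, u) \<in> PF_shuffle a b r s"
  shows "path_code a (v, u) \<in> paths s r a b"
proof -
  note D = PF_shuffleD[OF P]
  let ?g = "path_code a (v, u)"
  have pf: "(v, u) \<in> parking_functions (a + b)"
    using P by (simp add: PF_shuffle_def)
  have "?g ! i \<le> Suc ((0 # ?g) ! i)" if i: "i < length ?g" for i
  proof (cases i)
    case 0
    then show ?thesis using pf i D(1) by (auto simp: parking_functions_def)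
  next
    case (Suc k)
    then have k: "Suc k < a + b" using i D(1) by simp
    then have le: "u ! Suc k \<le> Suc (u ! k)" and
      gt: "u ! Suc k = Suc (u ! k) \<Longrightarrow> v ! Suc k > v ! k"
      using pf unfolding parking_functions_def by force+
    \<comment> \<open>If both cars were of one kind, the upper one, lying on a higher diagonal,
      would be read first and be smaller, against the increase in columns.\<close>
    have "v ! k \<le> a \<and> \<not> v ! Suc k \<le> a" if "u ! Suc k = Suc (u ! k)"
    proof (cases "v ! Suc k \<le> a \<longleftrightarrow> v ! k \<le> a")
      case True
      then have "v ! Suc k < v ! k"
        using PF_shuffle_less_iff[OF P, of "Suc k" k] k that by (simp add: reads_before_def)
      then show ?thesis using gt that by simp
    next
      case False
      then show ?thesis using gt that by auto
    qed
    then show ?thesis using le k D(1) Suc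
      by (cases "u ! Suc k = Suc (u ! k)") (auto simp: nth_append)
  qed
  then have steps: "small_steps 0 ?g" unfolding small_steps_iff_nth by blast
  have "length (filter odd ?g) = card {i. i < length v \<and> v ! i \<le> a}"
    using D(1,2) by (auto simp: length_filter_conv_card intro!: arg_cong[of _ _ card])
  also have "\<dots> = length (filter (\<lambda>x. x \<le> a) v)"
    by (simp only: length_filter_conv_card)
  also have "\<dots> = card (set (filter (\<lambda>x. x \<le> a) v))"
    using D(3) by (intro distinct_card[symmetric] distinct_filter)
  also have "set (filter (\<lambda>x. x \<le> a) v) = {1..a}" using D(4) by auto
  finally have odd: "length (filter odd ?g) = a" by simp
  then have "length (filter even ?g) = b"
    using sum_length_filter_compl[of odd ?g] D(1) by simp
  with odd steps show ?thesis
    using P count_path_code[of a v u] by (simp add: paths_def PF_shuffle_def)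
qed

text \<open>Two cars of one kind never contribute to dinv, by their reading order. For cars of
  different kinds the comparison of cars is decided by the kinds, and the two clauses of dinv are
  the two ways in which the codes can differ by one.\<close>

lemma dinv_eq_unit_drops:
  assumes P: "(v, u) \<in> PF_shuffle a b r s"
  shows "dinv (v, u) = unit_drops (path_code a (v, u))"
proof -
  note D = PF_shuffleD[OF P]
  let ?g = "path_code a (v, u)"
  let ?A = "{(i, j). i < j \<and> j < length u \<and> u ! i = u ! j \<and> v ! i < v ! j}"
  let ?B = "{(i, j). i < j \<and> j < length u \<and> u ! i = u ! j + 1 \<and> v ! i > v ! j}"
  have fin: "finite ?A" "finite ?B"
    by (rule finite_subset[of _ "{..<length u} \<times> {..<length u}"]; auto)+
  have iff: "(u ! i = u ! j \<and> v ! i < v ! j) \<or> (u ! i = u ! j + 1 \<and> v ! i > v ! j) \<longleftrightarrow>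
    ?g ! i = Suc (?g ! j)" if "i < j" "j < length u" for i j
  proof -
    have "2 * x + of_bool p = Suc (2 * y + of_bool p') \<longleftrightarrow> x = y \<and> p \<and> \<not> p' \<or> x = y + 1 \<and> \<not> p \<and> p'"
      for x y :: nat and p p' by (cases p; cases p') (simp_all, presburger+)
    then have "?g ! i = Suc (?g ! j) \<longleftrightarrow>
      u ! i = u ! j \<and> v ! i \<le> a \<and> \<not> v ! j \<le> a \<or> u ! i = u ! j + 1 \<and> \<not> v ! i \<le> a \<and> v ! j \<le> a"
      using that by simp
    also have "\<dots> \<longleftrightarrow> (u ! i = u ! j \<and> v ! i < v ! j) \<or> (u ! i = u ! j + 1 \<and> v ! i > v ! j)"
    proof (cases "v ! i \<le> a \<longleftrightarrow> v ! j \<le> a")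
      case True
      then show ?thesis
        using PF_shuffle_less_iff[OF P, of i j] PF_shuffle_less_iff[OF P, of j i] that D(1)
        by (auto simp: reads_before_def)
    qed auto
    finally show ?thesis by blast
  qed
  have "dinv (v, u) = card (?A \<union> ?B)"
    using fin by (subst card_Un_disjoint) auto
  also have "?A \<union> ?B = {(i, j). i < j \<and> j < length ?g \<and> ?g ! i = Suc (?g ! j)}" (is "_ = ?C")
  proof -
    have "length ?g = length u" by simp
    then have eq: "(i, j) \<in> ?A \<union> ?B \<longleftrightarrow> (i, j) \<in> ?C" for i j
      unfolding Un_iff mem_Collect_eq case_prod_conv using iff[of i j] by metis
    show ?thesis
      by (intro equalityI subrelI) (erule iffD1[OF eq], erule iffD2[OF eq])
  qed
  finally show ?thesis by (simp only: unit_drops_eq_card)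
qed

text \<open>Halves of the code give \<open>u\<close>, hence the reading order, and parities give the
  kinds; the cars of each kind are then forced.\<close>

lemma inj_on_path_code: "inj_on (path_code a) (PF_shuffle a b r s)"
proof (rule inj_onI, clarify)
  fix v u v' u'
  assume P: "(v, u) \<in> PF_shuffle a b r s" and P': "(v', u') \<in> PF_shuffle a b r s"
    and eq: "path_code a (v, u) = path_code a (v', u')"
  note D = PF_shuffleD[OF P] and D' = PF_shuffleD[OF P']
  have "u ! i = u' ! i \<and> (v ! i \<le> a \<longleftrightarrow> v' ! i \<le> a)" if "i < a + b" for i
  proof -
    have "2 * u ! i + of_bool (v ! i \<le> a) = 2 * u' ! i + of_bool (v' ! i \<le> a)"
      using arg_cong[OF eq, of "\<lambda>l. l ! i"] that D(1) D'(1) by simp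
    then show ?thesis by (cases "v ! i \<le> a"; cases "v' ! i \<le> a") (simp_all, presburger+)
  qed
  then have "u = u'" and t: "\<And>i. i < a + b \<Longrightarrow> v ! i \<le> a \<longleftrightarrow> v' ! i \<le> a"
    using D(1) D'(1) by (auto intro: nth_equalityI)
  then have fl: "filter (\<lambda>i. v' ! i \<le> a) (reading_order u') = filter (\<lambda>i. v ! i \<le> a) (reading_order u)"
    "filter (\<lambda>i. \<not> v' ! i \<le> a) (reading_order u') = filter (\<lambda>i. \<not> v ! i \<le> a) (reading_order u)"
    using D(6) by (auto intro!: filter_cong)
  have "v ! i = v' ! i" if i: "i < a + b" for i
  proof (cases "v ! i \<le> a")
    case True
    have "map ((!) v) (filter (\<lambda>i. v ! i \<le> a) (reading_order u)) =
      map ((!) v') (filter (\<lambda>i. v ! i \<le> a) (reading_order u))"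
      using D(7) D'(7) unfolding fl by simp
    then show ?thesis using True i D(6) by (simp add: map_eq_conv)
  next
    case False
    have "map ((!) v) (filter (\<lambda>i. \<not> v ! i \<le> a) (reading_order u)) =
      map ((!) v') (filter (\<lambda>i. \<not> v ! i \<le> a) (reading_order u))"
      using D(8) D'(8) unfolding fl by simp
    then show ?thesis using False i D(6) by (simp add: map_eq_conv)
  qed
  then have "v = v'" using D(2) D'(2) by (auto intro: nth_equalityI)
  with \<open>u = u'\<close> show "v = v' \<and> u = u'" by simp
qed

text \<open>The inverse: halve the entries to get \<open>u\<close>, then label the odd positions
  with \<open>1..a\<close> and the even ones with \<open>a+1..a+b\<close>, each in reading
  order.\<close>

lemma path_code_surj:
  assumes g: "g \<in> paths s r a b"
  shows "g \<in> path_code a ` PF_shuffle a b r s"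
proof -
  have len: "length g = a + b"
    using g sum_length_filter_compl[of odd g] by (simp add: paths_def)
  define u where "u = map (\<lambda>x. x div 2) g"
  have lu: "length u = a + b" and u: "\<And>i. i < a + b \<Longrightarrow> u ! i = g ! i div 2"
    by (simp_all add: u_def len)
  have "u ! i < a + b" if "i < a + b" for i
    using small_steps_le[of 0 g "g ! i"] g that len u[OF that] by (auto simp: paths_def)
  then have set_ro: "set (reading_order u) = {..<a + b}"
    using set_reading_order[of u] lu by simp
  define ps where "ps = filter (\<lambda>i. odd (g ! i)) (reading_order u)"
  define qs where "qs = filter (\<lambda>i. \<not> odd (g ! i)) (reading_order u)"
  have dist: "distinct (reading_order u)"
    using distinct_if_sorted_wrt_asym[OF sorted_reading_order reads_before_asym] .
  then have "distinct ps" "distinct qs" by (simp_all add: ps_def qs_def)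
  then have "length ps = card (set ps)" "length qs = card (set qs)"
    by (simp_all only: distinct_card)
  moreover have "set ps = {i. i < length g \<and> odd (g ! i)}" "set qs = {i. i < length g \<and> even (g ! i)}"
    using set_ro len by (auto simp: ps_def qs_def)
  ultimately have lps: "length ps = a" "length qs = b"
    using g by (simp_all add: paths_def length_filter_conv_card)
  have set_pq: "set (ps @ qs) = {..<a + b}"
    using set_ro by (auto simp: ps_def qs_def)
  have "distinct (ps @ qs)" using dist by (auto simp: ps_def qs_def)
  then obtain f where f: "map f (ps @ qs) = [1..<a + b + 1]"
    using ex_map_eq[of "ps @ qs" "[1..<a + b + 1]"] lps by (auto simp del: upt_Suc)
  have "[1..<a + b + 1] = [1..<a + 1] @ [a + 1..<a + b + 1]"
    using upt_add_eq_append[of 1 "a + 1" b] by (simp add: add_ac del: upt_Suc)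
  with f have fp: "map f ps = [1..<a + 1]" and fq: "map f qs = [a + 1..<a + b + 1]"
    using lps by (auto simp del: upt_Suc)
  define v where "v = map f [0..<a + b]"
  have v: "v ! i = f i" if "i < a + b" for i using that by (simp add: v_def)
  have small: "f i \<le> a \<longleftrightarrow> odd (g ! i)" if "i < a + b" for i
  proof (cases "odd (g ! i)")
    case True
    then have "f i \<in> set (map f ps)" using that set_ro by (auto simp: ps_def)
    then show ?thesis using True unfolding fp by auto
  next
    case False
    then have "f i \<in> set (map f qs)" using that set_ro by (auto simp: qs_def)
    then show ?thesis using False unfolding fq by auto
  qed
  have "set v = f ` set (ps @ qs)" unfolding set_pq by (auto simp: v_def)
  also have "\<dots> = set (map f (ps @ qs))" by (simp only: set_map)
  also have "\<dots> = {1..a + b}" unfolding f by auto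
  finally have set_v: "set v = {1..a + b}" .
  then have "distinct v" by (intro card_distinct) (simp add: v_def)
  have code: "path_code a (v, u) = g"
    by (rule nth_equalityI) (auto simp: lu len u v small)
  have steps: "g ! i \<le> Suc ((0 # g) ! i)" if "i < a + b" for i
    using g that len by (auto simp: paths_def small_steps_iff_nth)
  have "u ! Suc k \<le> Suc (u ! k)" "u ! Suc k = Suc (u ! k) \<Longrightarrow> v ! k < v ! Suc k"
    if k: "Suc k < a + b" for k
  proof -
    have st: "g ! Suc k \<le> Suc (g ! k)" using steps[OF k] by simp
    then show "u ! Suc k \<le> Suc (u ! k)" using u k by simp
    assume "u ! Suc k = Suc (u ! k)"
    then have "g ! Suc k div 2 = Suc (g ! k div 2)" using u k by simp
    \<comment> \<open>A step of at most one raises the half only from an odd to an even number, that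
      is from a small car to a big one, so the cars increase.\<close>
    with st have "even (g ! Suc k)" "odd (g ! k)" by presburger+
    then have "v ! k \<le> a" "\<not> v ! Suc k \<le> a" using small v k by auto
    then show "v ! k < v ! Suc k" by simp
  qed
  moreover have "u ! 0 = 0" if "0 < a + b" using steps[of 0] u[of 0] that by simp
  ultimately have "(v, u) \<in> parking_functions (a + b)"
    using set_v \<open>distinct v\<close> lu
    by (auto simp: parking_functions_def permutations_of_set_def gr0_conv_Suc)
  moreover have "diagonal_word (v, u) \<in> shuffles [1..<a + 1] [a + 1..<a + b + 1]"
  proof -
    have word: "diagonal_word (v, u) = map f (reading_order u)"
      unfolding diagonal_word_eq using set_ro v by auto
    have "filter (\<lambda>i. f i \<le> a) (reading_order u) = ps"
      "filter (\<lambda>i. \<not> f i \<le> a) (reading_order u) = qs"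
      unfolding ps_def qs_def using set_ro small by (auto intro!: filter_cong)
    then show ?thesis
      unfolding word in_shuffles_upt_iff filter_map comp_def
      using fp fq by simp
  qed
  moreover have "small_on_diagonal a (v, u) = r" "big_on_diagonal a (v, u) = s"
    using g count_path_code[of a v u] unfolding code by (simp_all add: paths_def)
  ultimately have "(v, u) \<in> PF_shuffle a b r s" by (simp add: PF_shuffle_def)
  then show ?thesis using code by force
qed

section \<open>Specialisation to the indeterminate and conclusion\<close>

lemma qq_nonzero: "qq \<noteq> 0"
  by (simp add: qq_def Zero_fract_def eq_fract)

interpretation generic_q qq
  by unfold_locales (auto simp: qq_nonzero q_int_qq_nonzero)

lemma PF_sum_eq_path_sum:
  "(\<Sum>P\<in>PF_shuffle a b r s. qq powi (coarea P + int (dinv P))) =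
     qq ^ ((a + b) choose 2) * path_sum s r a b"
proof -
  have "path_code a ` PF_shuffle a b r s = paths s r a b"
    using path_code_in_paths path_code_surj by fast
  then have "path_sum s r a b = (\<Sum>P\<in>PF_shuffle a b r s. weight (path_code a P))"
    unfolding path_sum_def using sum.reindex[OF inj_on_path_code, of weight a b r s] by simp
  moreover have "qq powi (coarea P + int (dinv P)) = qq ^ ((a + b) choose 2) * weight (path_code a P)"
    if "P \<in> PF_shuffle a b r s" for P
  proof -
    obtain v u where P: "P = (v, u)" by fastforce
    have "coarea P + int (dinv P) = int ((a + b) choose 2) +
      (int (unit_drops (path_code a P)) - int (half_sum (path_code a P)))"
      using dinv_eq_unit_drops[of v u a b r s] half_sum_path_code[of a v u] PF_shuffleD(1)[of v u a b r s] that
      unfolding P by simp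
    then show ?thesis
      by (simp only: weight_def power_int_add[OF disjI1[OF qq_nonzero]] power_int_of_nat)
  qed
  ultimately show ?thesis by (simp add: sum_distrib_left)
qed

theorem theorem1p1:
  fixes a b :: nat
  shows
    "(\<forall>r s :: nat. s < b \<and> r \<le> a \<longrightarrow>
        (\<Sum>P\<in>PF_shuffle a b r s. qq powi (coarea P + int (dinv P))) =
          qq powi (int ((a + b) choose 2) - (int a - int r + 1) * (int b - int s)) *
          q_binomial qq (a + b - s - 1) a *
          q_binomial qq (a - r + (b - s)) (a - r) *
          q_binomial qq (r + s) s *
          (q_int qq r / q_int qq (a - r + (b - s)))) \<and>
     (\<forall>r :: nat. r \<le> a \<longrightarrow>
        (\<Sum>P\<in>PF_shuffle a b r b. qq powi (coarea P + int (dinv P))) =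
          (if a = r then 1 else 0) * qq ^ ((a + b) choose 2) * q_binomial qq (a + b) a)"
proof (intro conjI allI impI; (elim conjE)?)
  fix r s assume "s < b" "r \<le> a"
  \<comment> \<open>After removal of the zeros \<open>d\<close> even entries remain;
    \<open>s < b\<close> makes \<open>d\<close> positive, so the general branch of
    \<open>path_sum_closed\<close> applies.\<close>
  define c d where "c = a - r" and "d = b - s"
  have eqs: "a = c + r" "b = d + s" "d \<noteq> 0" "c + r + d - 1 = a + b - s - 1"
    using \<open>s < b\<close> \<open>r \<le> a\<close> by (auto simp: c_def d_def)
  have "path_sum s r a b = q_binomial qq (r + s) s * path_sum 0 r (c + r) d"
    using path_sum_zeros[of s b r a] \<open>s < b\<close> eqs by simp
  also have "path_sum 0 r (c + r) d = qq powi (- int (Suc c * d)) * q_binomial qq (a + b - s - 1) a *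
      q_binomial qq (c + d) c * (q_int qq r / q_int qq (c + d))"
    unfolding path_sum_closed using eqs by simp
  finally have "(\<Sum>P\<in>PF_shuffle a b r s. qq powi (coarea P + int (dinv P))) =
    (qq ^ ((a + b) choose 2) * qq powi (- int (Suc c * d))) * q_binomial qq (a + b - s - 1) a *
      q_binomial qq (c + d) c * q_binomial qq (r + s) s * (q_int qq r / q_int qq (c + d))"
    unfolding PF_sum_eq_path_sum by (simp only: mult_ac)
  also have "qq ^ ((a + b) choose 2) * qq powi (- int (Suc c * d)) =
    qq powi (int ((a + b) choose 2) - (int a - int r + 1) * (int b - int s))"
  proof -
    have "int ((a + b) choose 2) - (int a - int r + 1) * (int b - int s) =
      int ((a + b) choose 2) + - int (Suc c * d)"
      using eqs by (simp add: algebra_simps)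
    then show ?thesis
      by (simp only: power_int_add[OF disjI1[OF qq_nonzero]] power_int_of_nat)
  qed
  finally show "(\<Sum>P\<in>PF_shuffle a b r s. qq powi (coarea P + int (dinv P))) =
          qq powi (int ((a + b) choose 2) - (int a - int r + 1) * (int b - int s)) *
          q_binomial qq (a + b - s - 1) a *
          q_binomial qq (a - r + (b - s)) (a - r) *
          q_binomial qq (r + s) s *
          (q_int qq r / q_int qq (a - r + (b - s)))"
    unfolding c_def d_def .
next
  fix r assume "r \<le> a"
  have "path_sum b r a b = q_binomial qq (r + b) b * path_sum 0 r (a - r + r) 0"
    using path_sum_zeros[of b b r a] \<open>r \<le> a\<close> by simp
  \<comment> \<open>All even entries were zeros, so this is the branch \<open>b = 0\<close> of the
    closed form, with \<open>a - r\<close> in the role of \<open>c\<close>.\<close>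
  also have "path_sum 0 r (a - r + r) 0 = (if a = r then 1 else 0)"
    unfolding path_sum_closed using \<open>r \<le> a\<close> by auto
  finally show "(\<Sum>P\<in>PF_shuffle a b r b. qq powi (coarea P + int (dinv P))) =
          (if a = r then 1 else 0) * qq ^ ((a + b) choose 2) * q_binomial qq (a + b) a"
    unfolding PF_sum_eq_path_sum using q_binomial_sym[of a b] by simp
qed

end
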